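(* Let $k$ be a field of characteristic zero. For every integer $n\geq 5$, there exists a simplicial complex on $n$ vertices, with no facet of cardinality one, which is not levelable.
   Context: A simplicial complex $\Delta$ on $V=\{x_1,\ldots,x_n\}$ is a collection of subsets of $V$ (faces) closed under taking subsets and with $\{x_i\}\in\Delta$ for all $i$; its facets are its faces that are maximal under inclusion. Let $R=k[x_1,\ldots,x_n]$ with $\deg x_i=1$. The Stanley-Reisner ideal is $I_\Delta=(x_{i_1}\cdots x_{i_s} \mid \{x_{i_1},\ldots,x_{i_s}\}\notin\Delta)\subseteq R$ (squarefree monomials). For integers $a_i\ge 2$, set $A(\Delta,a_1,\ldots,a_n)=R/(I_\Delta+(x_1^{a_1},\ldots,x_n^{a_n}))$, a graded artinian algebra. For a graded artinian algebra $A=R/I$, $\operatorname{soc}(A)=\{a\in A\mid a\overline{x}_i=0 \text{ for all } i\}$, and the socle-vector is $s(A)=(s_0,\ldots,s_e)$ with $s_i=\dim_k \operatorname{soc}(A)_i$, where $e$ is the largest index with $A_e\neq 0$. $A$ is level if $s_i=0$ for all $i\neq e$. $\Delta$ is levelable if there exists a tuple $(a_1,\ldots,a_n)$ of integers, each $a_i\ge 2$, such that $A(\Delta,a_1,\ldots,a_n)$ is level. *)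

theory Defs
  imports "HOL-Library.Poly_Mapping" "HOL-Algebra.QuotRing" "HOL-Algebra.Embedded_Algebras"
begin

text \<open>
  The variables \<open>x\<^sub>1, \<dots>, x\<^sub>n\<close> are represented by their indices \<open>1, \<dots>, n\<close>.
  A monomial is a finitely supported exponent function \<open>nat \<Rightarrow>\<^sub>0 nat\<close> and a polynomial a finitely
  supported coefficient function on monomials. Multiplication of the type \<open>'k mpoly\<close> is the
  convolution product of \<open>Poly_Mapping\<close>; the type itself has infinitely many variables, and
  \<open>poly_ring n\<close> is its subring of polynomials in \<open>x\<^sub>1, \<dots>, x\<^sub>n\<close> only.
\<close>

type_synonym 'k mpoly = "(nat \<Rightarrow>\<^sub>0 nat) \<Rightarrow>\<^sub>0 'k"

definition const_poly :: "'k::field \<Rightarrow> 'k mpoly" where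
  "const_poly c = Poly_Mapping.single 0 c"

definition var_poly :: "nat \<Rightarrow> 'k::field mpoly" where
  "var_poly i = Poly_Mapping.single (Poly_Mapping.single i 1) 1"

definition monom_degree :: "(nat \<Rightarrow>\<^sub>0 nat) \<Rightarrow> nat" where
  "monom_degree m = (\<Sum>i\<in>Poly_Mapping.keys m. Poly_Mapping.lookup m i)"

definition poly_ring :: "nat \<Rightarrow> 'k::field mpoly ring" where
  "poly_ring n =
     \<lparr>carrier = {p. \<forall>m\<in>Poly_Mapping.keys p. Poly_Mapping.keys m \<subseteq> {1..n}},
      monoid.mult = (*), one = 1, ring.zero = 0, add = (+)\<rparr>"

definition homogeneous_polys :: "nat \<Rightarrow> nat \<Rightarrow> 'k::field mpoly set" where
  "homogeneous_polys n d =
     {p \<in> carrier (poly_ring n). \<forall>m\<in>Poly_Mapping.keys p. monom_degree m = d}"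


text \<open>
  Below, \<open>I\<close> is a homogeneous ideal of \<open>poly_ring n\<close> with artinian quotient
  \<open>A = poly_ring n Quot I\<close>, whose elements are the cosets \<open>I +> p\<close>.
\<close>

definition graded_piece :: "nat \<Rightarrow> 'k::field mpoly set \<Rightarrow> nat \<Rightarrow> 'k mpoly set set" where
  "graded_piece n I d = (\<lambda>p. I +>\<^bsub>poly_ring n\<^esub> p) ` homogeneous_polys n d"

definition base_field :: "nat \<Rightarrow> 'k::field mpoly set \<Rightarrow> 'k mpoly set set" where
  "base_field n I = (\<lambda>c. I +>\<^bsub>poly_ring n\<^esub> const_poly c) ` UNIV"

definition socle :: "nat \<Rightarrow> 'k::field mpoly set \<Rightarrow> 'k mpoly set set" where
  "socle n I =
     {a \<in> carrier (poly_ring n Quot I).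
        \<forall>i\<in>{1..n}. a \<otimes>\<^bsub>poly_ring n Quot I\<^esub> (I +>\<^bsub>poly_ring n\<^esub> var_poly i)
          = \<zero>\<^bsub>poly_ring n Quot I\<^esub>}"

definition socle_degree :: "nat \<Rightarrow> 'k::field mpoly set \<Rightarrow> nat" where
  "socle_degree n I = (GREATEST d. graded_piece n I d \<noteq> {\<zero>\<^bsub>poly_ring n Quot I\<^esub>})"

text \<open>The entry \<open>s\<^sub>d\<close> of the socle-vector: the dimension of \<open>soc(A)\<^sub>d\<close> over the image of \<open>k\<close> in \<open>A\<close>.\<close>

definition socle_vector :: "nat \<Rightarrow> 'k::field mpoly set \<Rightarrow> nat \<Rightarrow> nat" where
  "socle_vector n I d =
     ring.dim (poly_ring n Quot I) (base_field n I) (socle n I \<inter> graded_piece n I d)"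

definition level :: "nat \<Rightarrow> 'k::field mpoly set \<Rightarrow> bool" where
  "level n I \<longleftrightarrow>
     (\<forall>d\<le>socle_degree n I. d \<noteq> socle_degree n I \<longrightarrow> socle_vector n I d = 0)"


definition simplicial_complex :: "nat \<Rightarrow> nat set set \<Rightarrow> bool" where
  "simplicial_complex n \<Delta> \<longleftrightarrow>
     \<Delta> \<subseteq> Pow {1..n} \<and> (\<forall>F\<in>\<Delta>. \<forall>G\<subseteq>F. G \<in> \<Delta>) \<and> (\<forall>i\<in>{1..n}. {i} \<in> \<Delta>)"

definition facets :: "nat set set \<Rightarrow> nat set set" where
  "facets \<Delta> = {F \<in> \<Delta>. \<forall>G\<in>\<Delta>. F \<subseteq> G \<longrightarrow> G = F}"

definition stanley_reisner_ideal :: "nat \<Rightarrow> nat set set \<Rightarrow> 'k::field mpoly set" where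
  "stanley_reisner_ideal n \<Delta> =
     Idl\<^bsub>poly_ring n\<^esub> {\<Prod>i\<in>F. var_poly i | F. F \<subseteq> {1..n} \<and> F \<notin> \<Delta>}"

text \<open>The defining ideal of \<open>A(\<Delta>, a\<^sub>1, \<dots>, a\<^sub>n)\<close>; only the values \<open>a 1, \<dots>, a n\<close> are used.\<close>

definition artinian_ideal :: "nat \<Rightarrow> nat set set \<Rightarrow> (nat \<Rightarrow> nat) \<Rightarrow> 'k::field mpoly set" where
  "artinian_ideal n \<Delta> a =
     stanley_reisner_ideal n \<Delta>
       <+>\<^bsub>poly_ring n\<^esub> Idl\<^bsub>poly_ring n\<^esub> ((\<lambda>i. var_poly i ^ a i) ` {1..n})"

text \<open>The type argument names the field \<open>k\<close>, which does not occur in the other arguments.\<close>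

definition levelable :: "'k::field itself \<Rightarrow> nat \<Rightarrow> nat set set \<Rightarrow> bool" where
  "levelable (_ :: 'k itself) n \<Delta> \<longleftrightarrow>
     (\<exists>a :: nat \<Rightarrow> nat. (\<forall>i\<in>{1..n}. 2 \<le> a i) \<and>
        level n (artinian_ideal n \<Delta> a :: 'k mpoly set))"

end

theory Submission
  imports Defs
begin

text \<open>
  If \<open>F\<close> is a facet of \<open>\<Delta>\<close>, then \<open>\<Prod>\<^sub>i\<^sub>\<in>\<^sub>F x\<^sub>i ^ (a\<^sub>i - 1)\<close> is a nonzero element of the socle of
  \<open>A(\<Delta>, a\<^sub>1, \<dots>, a\<^sub>n)\<close>. So if this algebra is level, then the sum of \<open>b\<^sub>i = a\<^sub>i - 1 > 0\<close> over a facet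
  is the same number \<open>w\<close> for all facets. This is impossible for the complex with facets
  \<open>{1, 2}\<close>, \<open>{3, 4}\<close>, \<open>{1, 3, 5, \<dots>, n}\<close> and \<open>{2, 4, 5, \<dots>, n}\<close>: the first two give
  \<open>2 w = b\<^sub>1 + b\<^sub>2 + b\<^sub>3 + b\<^sub>4\<close>, the last two \<open>2 w = b\<^sub>1 + b\<^sub>2 + b\<^sub>3 + b\<^sub>4 + 2 (b\<^sub>5 + \<dots> + b\<^sub>n)\<close>.
\<close>

section \<open>Exponent vectors and the polynomial ring\<close>

lemma keys_add_nat:
  fixes m m' :: "'a \<Rightarrow>\<^sub>0 nat"
  shows "Poly_Mapping.keys (m + m') = Poly_Mapping.keys m \<union> Poly_Mapping.keys m'"
  by (auto simp: in_keys_iff lookup_add)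

lemma monom_degree_eq_sum:
  assumes "finite S" "Poly_Mapping.keys m \<subseteq> S"
  shows "monom_degree m = sum (Poly_Mapping.lookup m) S"
  unfolding monom_degree_def
  using assms by (intro sum.mono_neutral_left) (auto simp: in_keys_iff)

lemma poly_ring_simps [simp]:
  "p \<in> carrier (poly_ring n) \<longleftrightarrow> (\<forall>m\<in>Poly_Mapping.keys p. Poly_Mapping.keys m \<subseteq> {1..n})"
  "p \<otimes>\<^bsub>poly_ring n\<^esub> q = p * q"
  "p \<oplus>\<^bsub>poly_ring n\<^esub> q = p + q"
  "\<one>\<^bsub>poly_ring n\<^esub> = 1"
  "\<zero>\<^bsub>poly_ring n\<^esub> = 0"
  by (simp_all add: poly_ring_def)

lemma poly_ring_cring: "cring (poly_ring n :: 'k::field mpoly ring)"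
proof (rule cringI)
  show "abelian_group (poly_ring n :: 'k mpoly ring)"
  proof (rule abelian_groupI)
    fix p q :: "'k mpoly"
    assume p: "p \<in> carrier (poly_ring n)"
    show "\<exists>q\<in>carrier (poly_ring n). q \<oplus>\<^bsub>poly_ring n\<^esub> p = \<zero>\<^bsub>poly_ring n\<^esub>"
      using p by (intro bexI[of _ "- p"]) (auto simp: in_keys_iff)
    assume "q \<in> carrier (poly_ring n)"
    then show "p \<oplus>\<^bsub>poly_ring n\<^esub> q \<in> carrier (poly_ring n)"
      using p Poly_Mapping.keys_add[of p q] by auto
  qed (auto simp: algebra_simps)
  show "Group.comm_monoid (poly_ring n :: 'k mpoly ring)"
  proof (rule comm_monoidI)
    fix p q :: "'k mpoly"
    assume "p \<in> carrier (poly_ring n)" "q \<in> carrier (poly_ring n)"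
    then show "p \<otimes>\<^bsub>poly_ring n\<^esub> q \<in> carrier (poly_ring n)"
      using keys_mult[of p q] by (fastforce simp: keys_add_nat)
  qed (auto simp: algebra_simps)
qed (auto simp: algebra_simps)

lemma poly_ring_ring: "ring (poly_ring n :: 'k::field mpoly ring)"
  using poly_ring_cring cring.axioms(1) by blast

text \<open>By uniqueness of additive inverses, the negation derived from the ring record agrees
  with the minus of the type, whose keys are easy to describe.\<close>

lemma poly_ring_uminus:
  assumes "(p :: 'k::field mpoly) \<in> carrier (poly_ring n)"
  shows "\<ominus>\<^bsub>poly_ring n\<^esub> p = - p"
proof -
  interpret ring "poly_ring n :: 'k mpoly ring" by (rule poly_ring_ring)
  have "- p \<in> carrier (poly_ring n)"
    using assms by (auto simp: in_keys_iff)
  then show ?thesis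
    using minus_equality[of "- p" p] assms by simp
qed

section \<open>Scalars, homogeneous parts and sums of terms\<close>

text \<open>Dimensions are taken over a subfield of the ambient ring, so \<open>k\<close> has to
  appear inside the ring as the constants; \<open>base_field\<close> is the image of this
  copy.\<close>

lemma range_const_poly_subfield:
  "subfield (range const_poly) (poly_ring n :: 'k::field mpoly ring)"
proof -
  let ?R = "poly_ring n :: 'k mpoly ring"
  let ?K = "range (const_poly :: 'k \<Rightarrow> 'k mpoly)"
  interpret cring ?R by (rule poly_ring_cring)
  have carr: "?K \<subseteq> carrier ?R"
    by (auto simp: const_poly_def)
  have sub: "subring ?K ?R"
  proof (rule subringI[OF carr])
    show "\<one>\<^bsub>?R\<^esub> \<in> ?K"
      by (auto simp: const_poly_def intro!: image_eqI[of _ _ 1])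
    fix p assume p: "p \<in> ?K"
    then obtain c where c: "p = const_poly c"
      by blast
    have "\<ominus>\<^bsub>?R\<^esub> p = - p"
      using p carr by (intro poly_ring_uminus) blast
    also have "\<dots> = const_poly (- c)"
      by (simp add: c const_poly_def single_uminus)
    finally show "\<ominus>\<^bsub>?R\<^esub> p \<in> ?K"
      by simp
    fix q assume "q \<in> ?K"
    then obtain d where d: "q = const_poly d"
      by blast
    have "p \<otimes>\<^bsub>?R\<^esub> q = const_poly (c * d)" "p \<oplus>\<^bsub>?R\<^esub> q = const_poly (c + d)"
      by (simp_all add: c d const_poly_def mult_single single_add)
    then show "p \<otimes>\<^bsub>?R\<^esub> q \<in> ?K" "p \<oplus>\<^bsub>?R\<^esub> q \<in> ?K"
      by simp_all
  qed
  show ?thesis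
  proof (rule subfieldI[OF subcringI'[OF sub]])
    have inv: "const_poly c * const_poly (inverse c) = (1 :: 'k mpoly)" if "c \<noteq> 0" for c :: 'k
      using that by (simp add: const_poly_def mult_single)
    show "Units (?R\<lparr>carrier := ?K\<rparr>) = ?K - {\<zero>\<^bsub>?R\<^esub>}"
    proof (intro equalityI subsetI)
      fix p assume "p \<in> Units (?R\<lparr>carrier := ?K\<rparr>)"
      then show "p \<in> ?K - {\<zero>\<^bsub>?R\<^esub>}"
        by (auto simp: Units_def)
    next
      fix p assume "p \<in> ?K - {\<zero>\<^bsub>?R\<^esub>}"
      then obtain c where "p = const_poly c" "c \<noteq> 0"
        by (metis DiffE const_poly_def imageE insertCI poly_ring_simps(5) single_zero)
      then show "p \<in> Units (?R\<lparr>carrier := ?K\<rparr>)"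
        using inv[of c] by (auto simp: Units_def mult.commute intro!: exI[of _ "inverse c"])
    qed
  qed
qed

text \<open>Despite its name, \<open>subalgebra\<close> asks only for an additive subgroup closed
  under scalars, that is, a subspace; closure under products is not part of it.\<close>

lemma homogeneous_polys_subalgebra:
  "subalgebra (range const_poly) (homogeneous_polys n d) (poly_ring n :: 'k::field mpoly ring)"
proof -
  let ?R = "poly_ring n :: 'k mpoly ring"
  interpret ring ?R by (rule poly_ring_ring)
  show ?thesis
  proof (intro subalgebra.intro add.subgroupI)
    show "homogeneous_polys n d \<subseteq> carrier ?R"
      by (auto simp: homogeneous_polys_def)
    have "0 \<in> (homogeneous_polys n d :: 'k mpoly set)"
      by (simp add: homogeneous_polys_def)
    then show "homogeneous_polys n d \<noteq> ({} :: 'k mpoly set)"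
      by blast
    fix p :: "'k mpoly"
    assume p: "p \<in> homogeneous_polys n d"
    then have "\<ominus>\<^bsub>?R\<^esub> p = - p"
      by (intro poly_ring_uminus) (auto simp: homogeneous_polys_def)
    moreover have "- p \<in> homogeneous_polys n d"
      using p by (auto simp: homogeneous_polys_def in_keys_iff)
    ultimately show "\<ominus>\<^bsub>?R\<^esub> p \<in> homogeneous_polys n d"
      by simp
    fix q :: "'k mpoly"
    assume "q \<in> homogeneous_polys n d"
    then show "p \<oplus>\<^bsub>?R\<^esub> q \<in> homogeneous_polys n d"
      using p Poly_Mapping.keys_add[of p q] by (simp add: homogeneous_polys_def subset_iff) blast
  next
    show "subalgebra_axioms (range const_poly) (homogeneous_polys n d) ?R"
    proof
      fix k p :: "'k mpoly"
      assume "k \<in> range const_poly" and p: "p \<in> homogeneous_polys n d"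
      then obtain c where "k = Poly_Mapping.single 0 c"
        by (auto simp: const_poly_def)
      \<comment> \<open>A constant has exponent 0 and so shifts no monomial. Only an inclusion
        holds, since the constant may be zero.\<close>
      then have "Poly_Mapping.keys (k * p) \<subseteq> Poly_Mapping.keys p"
        using keys_mult[of k p] by (auto split: if_splits)
      then show "k \<otimes>\<^bsub>?R\<^esub> p \<in> homogeneous_polys n d"
        using p by (auto simp: homogeneous_polys_def)
    qed
  qed
qed

text \<open>Each exponent is at most \<open>d\<close> and is 0 outside \<open>{1..n}\<close>, which
  leaves finitely many exponent functions.\<close>

lemma finite_monomials_degree:
  "finite {m :: nat \<Rightarrow>\<^sub>0 nat. Poly_Mapping.keys m \<subseteq> {1..n} \<and> monom_degree m = d}"
proof -
  let ?M = "{m :: nat \<Rightarrow>\<^sub>0 nat. Poly_Mapping.keys m \<subseteq> {1..n} \<and> monom_degree m = d}"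
  let ?B = "{f. \<forall>i. (i \<in> {1..n} \<longrightarrow> f i \<in> {..d}) \<and> (i \<notin> {1..n} \<longrightarrow> f i = (0::nat))}"
  have "Poly_Mapping.lookup ` ?M \<subseteq> ?B"
  proof
    fix f assume "f \<in> Poly_Mapping.lookup ` ?M"
    then obtain m where m: "Poly_Mapping.keys m \<subseteq> {1..n}" "monom_degree m = d"
      and f: "f = Poly_Mapping.lookup m"
      by blast
    have "f i = 0" if "i \<notin> {1..n}" for i
      using that m by (auto simp: f in_keys_iff)
    moreover have "f i \<le> d" if "i \<in> {1..n}" for i
      using that member_le_sum[of i "{1..n}" f] monom_degree_eq_sum[OF _ m(1)] m(2)
      by (simp add: f)
    ultimately show "f \<in> ?B"
      by blast
  qed
  moreover have "finite ?B"
    by (rule finite_set_of_finite_funs) simp_all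
  ultimately have "finite (Poly_Mapping.lookup ` ?M)"
    by (rule finite_subset)
  then show ?thesis
    by (rule finite_imageD) (rule inj_onI, simp add: lookup_inject)
qed

text \<open>A polynomial is the finite sum of its terms, so membership in a set closed under
  addition can be checked term by term. It serves below for a span and for an ideal.\<close>

lemma poly_mapping_in_additive_set:
  fixes p :: "'a \<Rightarrow>\<^sub>0 'b::ab_group_add"
  assumes "0 \<in> V" "\<And>p q. p \<in> V \<Longrightarrow> q \<in> V \<Longrightarrow> p + q \<in> V"
    and "\<And>m. m \<in> Poly_Mapping.keys p \<Longrightarrow> Poly_Mapping.single m (Poly_Mapping.lookup p m) \<in> V"
  shows "p \<in> V"
proof -
  have "p = (\<Sum>m\<in>Poly_Mapping.keys p. Poly_Mapping.single m (Poly_Mapping.lookup p m))"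
    by (rule poly_mapping_eqI)
      (simp add: lookup_sum lookup_single when_def in_keys_iff)
  also have "(\<Sum>m\<in>M. Poly_Mapping.single m (Poly_Mapping.lookup p m)) \<in> V"
    if "finite M" "M \<subseteq> Poly_Mapping.keys p" for M
    using that by (induction rule: finite_induct) (auto intro: assms)
  then have "(\<Sum>m\<in>Poly_Mapping.keys p. Poly_Mapping.single m (Poly_Mapping.lookup p m)) \<in> V"
    by simp
  finally show ?thesis .
qed

section \<open>Graded pieces of the quotient\<close>

lemma coset_eq_ideal_iff:
  assumes "ideal I (poly_ring n)" "p \<in> carrier (poly_ring n)"
  shows "I +>\<^bsub>poly_ring n\<^esub> p = I \<longleftrightarrow> (p :: 'k::field mpoly) \<in> I"
  using ideal.rcos_const_imp_mem[OF assms] ring.a_rcos_zero[OF poly_ring_ring assms(1)] by blast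

lemma Quot_zero [simp]: "\<zero>\<^bsub>R Quot I\<^esub> = I"
  by (simp add: FactRing_def)

text \<open>As 1 is not in \<open>I\<close>, the quotient is a nonzero ring, and the image of a
  subfield in a nonzero ring is again a subfield.\<close>

lemma base_field_subfield:
  assumes "ideal I (poly_ring n)" "1 \<notin> I"
  shows "subfield (base_field n I) (poly_ring n Quot (I :: 'k::field mpoly set))"
proof -
  interpret h: ring_hom_ring "poly_ring n :: 'k mpoly ring" "poly_ring n Quot I"
    "(+>\<^bsub>poly_ring n\<^esub>) I"
    using assms(1) by (rule ideal.rcos_ring_hom_ring)
  have "\<one>\<^bsub>poly_ring n Quot I\<^esub> \<noteq> \<zero>\<^bsub>poly_ring n Quot I\<^esub>"
    using coset_eq_ideal_iff[OF assms(1), of 1] assms(2) by (simp add: FactRing_def)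
  then show ?thesis
    using h.img_is_subfield(2)[OF range_const_poly_subfield]
    by (simp add: base_field_def image_image)
qed

lemma graded_piece_subalgebra:
  assumes "ideal I (poly_ring n)"
  shows "subalgebra (base_field n I) (graded_piece n I d)
    (poly_ring n Quot (I :: 'k::field mpoly set))"
proof -
  interpret h: ring_hom_ring "poly_ring n :: 'k mpoly ring" "poly_ring n Quot I"
    "(+>\<^bsub>poly_ring n\<^esub>) I"
    using assms(1) by (rule ideal.rcos_ring_hom_ring)
  show ?thesis
    using h.img_is_subalgebra[OF subfieldE(3)[OF range_const_poly_subfield] homogeneous_polys_subalgebra]
    by (simp add: base_field_def graded_piece_def image_image)
qed

text \<open>The classes of the finitely many monomials of degree \<open>d\<close> span the piece.
  This matters because \<open>ring.dim\<close> is informative only when a dimension exists.\<close>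

lemma graded_piece_finite_dimension:
  assumes I: "ideal I (poly_ring n)" and one: "1 \<notin> I"
  shows "ring.finite_dimension (poly_ring n Quot (I :: 'k::field mpoly set)) (base_field n I)
    (graded_piece n I d)"
proof -
  let ?R = "poly_ring n :: 'k mpoly ring"
  let ?A = "?R Quot I" and ?K = "base_field n I"
  let ?h = "(+>\<^bsub>?R\<^esub>) I"
  interpret h: ring_hom_ring ?R ?A ?h
    using I by (rule ideal.rcos_ring_hom_ring)
  note K = base_field_subfield[OF I one]
  \<comment> \<open>\<open>Span\<close> takes a list of generators, so the monomials are
    enumerated.\<close>
  obtain ms where ms:
    "set ms = {m :: nat \<Rightarrow>\<^sub>0 nat. Poly_Mapping.keys m \<subseteq> {1..n} \<and> monom_degree m = d}"
    using finite_list[OF finite_monomials_degree] by blast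
  define Us where "Us = map (\<lambda>m. ?h (Poly_Mapping.single m 1)) ms"
  have Us: "set Us \<subseteq> carrier ?A"
    unfolding Us_def using ms by (auto intro!: h.hom_closed)
  interpret S: subalgebra ?K "h.S.Span ?K Us" ?A
    using K Us by (rule h.S.Span_is_subalgebra)
  have "graded_piece n I d \<subseteq> h.S.Span ?K Us"
  proof
    fix u assume "u \<in> graded_piece n I d"
    then obtain p where p: "p \<in> homogeneous_polys n d" and u: "u = ?h p"
      by (auto simp: graded_piece_def)
    \<comment> \<open>The preimage of the span under the quotient map is closed under addition, so
      it is enough to treat the terms of \<open>p\<close>, each a constant times a monomial.\<close>
    have "p \<in> {q \<in> carrier ?R. ?h q \<in> h.S.Span ?K Us}"
    proof (rule poly_mapping_in_additive_set)
      show "0 \<in> {q \<in> carrier ?R. ?h q \<in> h.S.Span ?K Us}"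
        using S.one_closed h.hom_zero by (simp del: Quot_zero)
    next
      fix q r
      assume "q \<in> {q \<in> carrier ?R. ?h q \<in> h.S.Span ?K Us}"
        and "r \<in> {q \<in> carrier ?R. ?h q \<in> h.S.Span ?K Us}"
      then show "q + r \<in> {q \<in> carrier ?R. ?h q \<in> h.S.Span ?K Us}"
        using h.hom_add[of q r] S.m_closed[of "?h q" "?h r"] h.R.add.m_closed[of q r] by simp
    next
      fix m assume m: "m \<in> Poly_Mapping.keys p"
      let ?c = "Poly_Mapping.lookup p m"
      have mem: "m \<in> set ms"
        using p m by (auto simp: homogeneous_polys_def ms)
      then have "?h (Poly_Mapping.single m 1) \<in> set Us"
        by (auto simp: Us_def)
      then have "?h (Poly_Mapping.single m 1) \<in> h.S.Span ?K Us"
        using h.S.Span_base_incl[OF K Us] by blast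
      then have "?h (const_poly ?c) \<otimes>\<^bsub>?A\<^esub> ?h (Poly_Mapping.single m 1) \<in> h.S.Span ?K Us"
        by (intro S.smult_closed) (auto simp: base_field_def)
      moreover have "?h (const_poly ?c) \<otimes>\<^bsub>?A\<^esub> ?h (Poly_Mapping.single m 1)
          = ?h (Poly_Mapping.single m ?c)"
        using mem h.hom_mult[of "const_poly ?c" "Poly_Mapping.single m 1"]
        by (simp add: ms const_poly_def mult_single)
      ultimately show "Poly_Mapping.single m ?c \<in> {q \<in> carrier ?R. ?h q \<in> h.S.Span ?K Us}"
        using mem by (simp add: ms)
    qed
    then show "u \<in> h.S.Span ?K Us"
      by (simp add: u)
  qed
  then show ?thesis
    by (rule h.S.subalbegra_incl_imp_finite_dimension[OF K h.S.Span_finite_dimension[OF K Us]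
        graded_piece_subalgebra[OF I]])
qed

section \<open>The socle and vanishing entries of the socle-vector\<close>

text \<open>An annihilator is an ideal, hence closed under scalars from any \<open>K\<close>. The
  socle is the annihilator of the classes of the variables.\<close>

lemma (in cring) annihilator_subalgebra:
  assumes "K \<subseteq> carrier R" "X \<subseteq> carrier R"
  shows "subalgebra K {a \<in> carrier R. \<forall>x\<in>X. a \<otimes> x = \<zero>} R"
proof (rule ideal_is_subalgebra[OF assms(1)], rule idealI[OF ring_axioms])
  let ?N = "{a \<in> carrier R. \<forall>x\<in>X. a \<otimes> x = \<zero>}"
  have X: "x \<in> carrier R" if "x \<in> X" for x
    using that assms(2) by blast
  show "subgroup ?N (add_monoid R)"
  proof (rule add.subgroupI)
    have "\<zero> \<in> ?N"
      using X by simp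
    then show "?N \<noteq> {}"
      by blast
  next
    fix a assume "a \<in> ?N"
    then show "\<ominus> a \<in> ?N"
      using X by (simp add: l_minus)
  next
    fix a b assume "a \<in> ?N" "b \<in> ?N"
    then show "a \<oplus> b \<in> ?N"
      using X by (simp add: l_distr)
  qed blast
  fix a y
  assume a: "a \<in> ?N" and y: "y \<in> carrier R"
  then show "y \<otimes> a \<in> ?N"
    using X by (simp add: m_assoc)
  then show "a \<otimes> y \<in> ?N"
    using a y m_comm[of a y] by simp
qed

lemma socle_subalgebra:
  assumes "ideal I (poly_ring n)"
  shows "subalgebra (base_field n I) (socle n I) (poly_ring n Quot (I :: 'k::field mpoly set))"
proof -
  let ?R = "poly_ring n :: 'k mpoly ring"
  interpret A: cring "?R Quot I"
    using ideal.quotient_is_cring[OF assms poly_ring_cring] .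
  interpret h: ring_hom_ring ?R "?R Quot I" "(+>\<^bsub>?R\<^esub>) I"
    using assms by (rule ideal.rcos_ring_hom_ring)
  have "base_field n I \<subseteq> carrier (?R Quot I)"
    "(\<lambda>i. I +>\<^bsub>?R\<^esub> var_poly i) ` {1..n} \<subseteq> carrier (?R Quot I)"
    by (auto simp: base_field_def const_poly_def var_poly_def intro!: h.hom_closed)
  from A.annihilator_subalgebra[OF this] show ?thesis
    by (simp add: socle_def)
qed

text \<open>The intersection is a subspace of a finite-dimensional graded piece, so its dimension
  exists; if that is 0, only the zero of the quotient, which is the coset \<open>I\<close>,
  remains.\<close>

lemma socle_vector_eq_0_imp:
  assumes I: "ideal I (poly_ring n)" and one: "1 \<notin> I" and "socle_vector n I d = 0"
  shows "socle n I \<inter> graded_piece n I d = {I :: 'k::field mpoly set}"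
proof -
  let ?A = "poly_ring n Quot I"
  interpret A: ring ?A
    using I by (rule ideal.quotient_is_ring)
  note K = base_field_subfield[OF I one]
  have "A.finite_dimension (base_field n I) (socle n I \<inter> graded_piece n I d)"
    by (rule A.subalbegra_incl_imp_finite_dimension[OF K graded_piece_finite_dimension[OF I one]
        A.subalgebra_inter[OF socle_subalgebra[OF I] graded_piece_subalgebra[OF I]] Int_lower2])
  then have "A.dimension 0 (base_field n I) (socle n I \<inter> graded_piece n I d)"
    using A.finite_dimensionE[OF K] assms(3) by (fastforce simp: socle_vector_def over_def)
  then show ?thesis
    using A.dimension_zero[OF K] by fastforce
qed

section \<open>The defining ideal as a monomial ideal\<close>

text \<open>For monomials in the first \<open>n\<close> variables this describes those whose class
  in \<open>A(\<Delta>, a)\<close> is zero; \<open>keys m\<close> is the support.\<close>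

definition vanishing_monomial :: "nat \<Rightarrow> nat set set \<Rightarrow> (nat \<Rightarrow> nat) \<Rightarrow> (nat \<Rightarrow>\<^sub>0 nat) \<Rightarrow> bool" where
  "vanishing_monomial n \<Delta> a m \<longleftrightarrow>
     Poly_Mapping.keys m \<notin> \<Delta> \<or> (\<exists>i\<in>{1..n}. a i \<le> Poly_Mapping.lookup m i)"

text \<open>Passing to a multiple enlarges support and exponents. A non-face stays a non-face
  because faces are closed under subsets.\<close>

lemma vanishing_monomial_add:
  assumes "simplicial_complex n \<Delta>" "vanishing_monomial n \<Delta> a m"
  shows "vanishing_monomial n \<Delta> a (m' + m)"
proof -
  have "Poly_Mapping.keys m \<in> \<Delta>" if "Poly_Mapping.keys (m' + m) \<in> \<Delta>"
    using that assms(1) by (auto simp: simplicial_complex_def keys_add_nat)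
  then show ?thesis
    using assms(2) unfolding vanishing_monomial_def lookup_add by (meson trans_le_add2)
qed

lemma var_poly_power:
  "var_poly i ^ e = (Poly_Mapping.single (Poly_Mapping.single i e) 1 :: 'k::field mpoly)"
  by (induction e) (simp_all add: var_poly_def mult_single single_add[symmetric] add.commute)

lemma prod_var_poly:
  "(\<Prod>i\<in>F. var_poly i) = (Poly_Mapping.single (\<Sum>i\<in>F. Poly_Mapping.single i 1) 1 :: 'k::field mpoly)"
  \<comment> \<open>For infinite \<open>F\<close> the product and the sum default to 1 and 0, and 1
    is the monomial with exponent 0.\<close>
  by (induction F rule: infinite_finite_induct) (simp_all add: var_poly_def mult_single)

lemma lookup_sum_single:
  assumes "finite F"
  shows "Poly_Mapping.lookup (\<Sum>i\<in>F. Poly_Mapping.single i (b i)) j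
    = (if j \<in> F then b j else (0::nat))"
  using assms by (simp add: lookup_sum lookup_single when_def)

lemma keys_sum_single:
  assumes "finite F" "\<forall>i\<in>F. b i \<noteq> (0::nat)"
  shows "Poly_Mapping.keys (\<Sum>i\<in>F. Poly_Mapping.single i (b i)) = F"
  using assms by (auto simp: in_keys_iff lookup_sum_single split: if_splits)

text \<open>Every monomial of a product \<open>q * p\<close> is a multiple of a monomial of
  \<open>p\<close>, so a property inherited by multiples of monomials cuts out an ideal.\<close>

lemma monomial_ideal:
  assumes "\<And>m m'. P m \<Longrightarrow> P (m' + m)"
  shows "ideal {p \<in> carrier (poly_ring n). \<forall>m\<in>Poly_Mapping.keys p. P m}
    (poly_ring n :: 'k::field mpoly ring)"
proof -
  let ?R = "poly_ring n :: 'k mpoly ring"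
  let ?J = "{p \<in> carrier ?R. \<forall>m\<in>Poly_Mapping.keys p. P m}"
  interpret cring ?R by (rule poly_ring_cring)
  show ?thesis
  proof (rule idealI[OF ring_axioms])
    show "subgroup ?J (add_monoid ?R)"
    proof (rule add.subgroupI)
      show "?J \<noteq> {}"
        by (auto intro!: exI[of _ 0])
      fix p assume p: "p \<in> ?J"
      then have "\<ominus>\<^bsub>?R\<^esub> p = - p"
        by (intro poly_ring_uminus) simp
      moreover have "- p \<in> ?J"
        using p by (auto simp: in_keys_iff)
      ultimately show "\<ominus>\<^bsub>?R\<^esub> p \<in> ?J"
        by simp
      fix q assume "q \<in> ?J"
      then show "p \<oplus>\<^bsub>?R\<^esub> q \<in> ?J"
        using p Poly_Mapping.keys_add[of p q] by (simp add: subset_iff) blast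
    qed auto
    fix p q assume p: "p \<in> ?J" and q: "q \<in> carrier ?R"
    have "q \<otimes>\<^bsub>?R\<^esub> p \<in> carrier ?R"
      using p q by (intro m_closed) simp_all
    moreover have "\<forall>m\<in>Poly_Mapping.keys (q * p). P m"
      using keys_mult[of q p] p assms by fastforce
    ultimately show "q \<otimes>\<^bsub>?R\<^esub> p \<in> ?J"
      by simp
    then show "p \<otimes>\<^bsub>?R\<^esub> q \<in> ?J"
      by (simp add: mult.commute)
  qed
qed

lemma single_in_ideal_if_divides:
  assumes I: "ideal I (poly_ring n)" and "Poly_Mapping.single g 1 \<in> I"
    and m: "Poly_Mapping.keys m \<subseteq> {1..n}"
    and le: "\<And>i. Poly_Mapping.lookup g i \<le> Poly_Mapping.lookup m i"
  shows "(Poly_Mapping.single m c :: 'k::field mpoly) \<in> I"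
proof -
  \<comment> \<open>Subtraction of exponents is truncated; divisibility makes it exact.\<close>
  have "(m - g) + g = m"
    by (rule poly_mapping_eqI) (simp add: lookup_add lookup_minus le)
  then have "Poly_Mapping.single m c = Poly_Mapping.single (m - g) c * Poly_Mapping.single g 1"
    by (simp add: mult_single)
  moreover have "Poly_Mapping.keys (m - g) \<subseteq> {1..n}"
    using m by (auto simp: in_keys_iff lookup_minus subset_iff)
  then have "Poly_Mapping.single (m - g) c \<in> carrier (poly_ring n)"
    by simp
  ultimately show ?thesis
    using ideal.I_l_closed[OF I assms(2), of "Poly_Mapping.single (m - g) c"] by simp
qed

text \<open>All generators are vanishing monomials, which gives one inclusion by minimality of
  generated ideals. Conversely every vanishing monomial is a multiple of a generator, and a
  polynomial is the sum of its terms.\<close>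

lemma artinian_ideal_eq:
  assumes \<Delta>: "simplicial_complex n \<Delta>"
  shows "(artinian_ideal n \<Delta> a :: 'k::field mpoly set)
    = {p \<in> carrier (poly_ring n). \<forall>m\<in>Poly_Mapping.keys p. vanishing_monomial n \<Delta> a m}"
    and "ideal (artinian_ideal n \<Delta> a :: 'k mpoly set) (poly_ring n)"
proof -
  let ?R = "poly_ring n :: 'k mpoly ring"
  let ?I = "artinian_ideal n \<Delta> a :: 'k mpoly set"
  let ?J = "{p \<in> carrier ?R. \<forall>m\<in>Poly_Mapping.keys p. vanishing_monomial n \<Delta> a m}"
  define S where "S = {\<Prod>i\<in>F. var_poly i | F. F \<subseteq> {1..n} \<and> F \<notin> \<Delta>}
    \<union> ((\<lambda>i. var_poly i ^ a i) ` {1..n} :: 'k mpoly set)"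
  interpret cring ?R by (rule poly_ring_cring)
  have fin: "finite F" if "F \<subseteq> {1..n}" for F :: "nat set"
    using that finite_subset by blast
  have J: "ideal ?J ?R"
    using vanishing_monomial_add[OF \<Delta>] by (rule monomial_ideal)
  have SJ: "S \<subseteq> ?J"
  proof
    fix p assume "p \<in> S"
    then consider F where "F \<subseteq> {1..n}" "F \<notin> \<Delta>" "p = (\<Prod>i\<in>F. var_poly i)"
      | i where "i \<in> {1..n}" "p = var_poly i ^ a i"
      unfolding S_def by blast
    then show "p \<in> ?J"
    proof cases
      case (1 F)
      then show ?thesis
        by (simp add: prod_var_poly keys_sum_single fin vanishing_monomial_def)
    next
      case (2 i)
      then show ?thesis
        by (auto simp: var_poly_power vanishing_monomial_def intro!: bexI[of _ i])
    qed
  qed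
  then have SJ1: "{\<Prod>i\<in>F. var_poly i | F. F \<subseteq> {1..n} \<and> F \<notin> \<Delta>} \<subseteq> ?J"
    and SJ2: "(\<lambda>i. var_poly i ^ a i) ` {1..n} \<subseteq> ?J"
    unfolding S_def by blast+
  have JR: "?J \<subseteq> carrier ?R"
    by blast
  note SR1 = subset_trans[OF SJ1 JR] and SR2 = subset_trans[OF SJ2 JR]
  note I1 = genideal_ideal[OF SR1] and I2 = genideal_ideal[OF SR2]
  \<comment> \<open>Writing the sum of two ideals as the ideal generated by their union makes
    minimality applicable to it.\<close>
  have I_Un: "?I = Idl\<^bsub>?R\<^esub> (stanley_reisner_ideal n \<Delta>
      \<union> Idl\<^bsub>?R\<^esub> ((\<lambda>i. var_poly i ^ a i) ` {1..n}))"
    unfolding artinian_ideal_def stanley_reisner_ideal_def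
    using union_genideal[OF I1 I2] by simp
  show I: "ideal ?I ?R"
    unfolding artinian_ideal_def stanley_reisner_ideal_def
    using add_ideals[OF I1 I2] .
  have SI: "S \<subseteq> ?I"
    unfolding I_Un stanley_reisner_ideal_def S_def
    using genideal_self[OF SR1] genideal_self[OF SR2] unfolding genideal_def by blast
  have "stanley_reisner_ideal n \<Delta> \<subseteq> ?J"
    unfolding stanley_reisner_ideal_def by (rule genideal_minimal[OF J SJ1])
  moreover have "Idl\<^bsub>?R\<^esub> ((\<lambda>i. var_poly i ^ a i) ` {1..n}) \<subseteq> ?J"
    by (rule genideal_minimal[OF J SJ2])
  ultimately have "?I \<subseteq> ?J"
    unfolding I_Un by (rule genideal_minimal[OF J Un_least])
  moreover have "?J \<subseteq> ?I"
  proof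
    fix p assume p: "p \<in> ?J"
    show "p \<in> ?I"
    proof (rule poly_mapping_in_additive_set)
      show "0 \<in> ?I"
        using additive_subgroup.zero_closed[OF ideal.axioms(1)[OF I]] by simp
      show "q + r \<in> ?I" if "q \<in> ?I" "r \<in> ?I" for q r
        using additive_subgroup.a_closed[OF ideal.axioms(1)[OF I] that] by simp
      fix m assume "m \<in> Poly_Mapping.keys p"
      then have m: "Poly_Mapping.keys m \<subseteq> {1..n}" and van: "vanishing_monomial n \<Delta> a m"
        using p by auto
      \<comment> \<open>The generator dividing \<open>m\<close> is a pure power if the support of
        \<open>m\<close> is a face, and otherwise the squarefree monomial on that support.\<close>
      obtain g where g: "(Poly_Mapping.single g 1 :: 'k mpoly) \<in> S"
        and le: "\<And>i. Poly_Mapping.lookup g i \<le> Poly_Mapping.lookup m i"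
      proof (cases "Poly_Mapping.keys m \<in> \<Delta>")
        case True
        then obtain i where "i \<in> {1..n}" "a i \<le> Poly_Mapping.lookup m i"
          using van by (auto simp: vanishing_monomial_def)
        then show ?thesis
          by (intro that[of "Poly_Mapping.single i (a i)"])
            (auto simp: S_def var_poly_power lookup_single when_def)
      next
        case False
        then have "Poly_Mapping.single (\<Sum>i\<in>Poly_Mapping.keys m. Poly_Mapping.single i 1) 1 \<in> S"
          unfolding S_def prod_var_poly[symmetric] using m by blast
        then show ?thesis
          by (rule that) (auto simp: lookup_sum_single in_keys_iff)
      qed
      show "Poly_Mapping.single m (Poly_Mapping.lookup p m) \<in> ?I"
        using single_in_ideal_if_divides[OF I _ m le] g SI by blast
    qed
  qed
  ultimately show "?I = ?J"
    by blast
qed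

section \<open>Facets and the socle degree\<close>

text \<open>In a monomial of degree above \<open>sum a {1..n}\<close> some exponent reaches
  \<open>a i\<close>, so the monomial vanishes. The bound guarantees that the
  \<open>GREATEST\<close> in \<open>socle_degree\<close> is attained.\<close>

lemma graded_piece_artinian_nonzero_imp_le:
  assumes \<Delta>: "simplicial_complex n \<Delta>"
    and "graded_piece n (artinian_ideal n \<Delta> a :: 'k::field mpoly set) d \<noteq> {artinian_ideal n \<Delta> a}"
  shows "d \<le> sum a {1..n}"
proof (rule ccontr)
  assume d: "\<not> d \<le> sum a {1..n}"
  let ?I = "artinian_ideal n \<Delta> a :: 'k mpoly set"
  have "?I +>\<^bsub>poly_ring n\<^esub> p = ?I" if p: "p \<in> homogeneous_polys n d" for p
  proof -
    have "vanishing_monomial n \<Delta> a m" if "m \<in> Poly_Mapping.keys p" for m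
    proof -
      have "monom_degree m = sum (Poly_Mapping.lookup m) {1..n}" "monom_degree m = d"
        using that p by (auto simp: homogeneous_polys_def intro!: monom_degree_eq_sum)
      then have "\<not> sum (Poly_Mapping.lookup m) {1..n} \<le> sum a {1..n}"
        using d by simp
      then have "\<exists>i\<in>{1..n}. a i \<le> Poly_Mapping.lookup m i"
        using sum_mono[of "{1..n}" "Poly_Mapping.lookup m" a] by (meson nat_le_linear)
      then show ?thesis
        by (simp add: vanishing_monomial_def)
    qed
    then show ?thesis
      using p artinian_ideal_eq(2)[OF \<Delta>, of a, where 'k = 'k]
      by (subst coset_eq_ideal_iff) (auto simp: artinian_ideal_eq(1)[OF \<Delta>] homogeneous_polys_def)
  qed
  \<comment> \<open>This makes the piece nonempty, so that it equals \<open>{?I}\<close> and is not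
    merely contained in it.\<close>
  moreover have "(0 :: 'k mpoly) \<in> homogeneous_polys n d"
    by (simp add: homogeneous_polys_def)
  ultimately have "graded_piece n ?I d = {?I}"
    unfolding graded_piece_def by (auto intro: image_eqI[of _ _ "0 :: 'k mpoly"])
  with assms(2) show False
    by simp
qed

text \<open>The class of the facet monomial is a nonzero socle element of degree \<open>d\<close>,
  so \<open>d\<close> is at most the socle degree. Were it smaller, levelness would leave no nonzero
  socle element in degree \<open>d\<close>.\<close>

lemma facet_weight_eq_socle_degree:
  assumes \<Delta>: "simplicial_complex n \<Delta>" and a: "\<forall>i\<in>{1..n}. 2 \<le> a i"
    and lev: "level n (artinian_ideal n \<Delta> a :: 'k::field mpoly set)"
    and F: "F \<in> facets \<Delta>"
  shows "(\<Sum>i\<in>F. a i - 1) = socle_degree n (artinian_ideal n \<Delta> a :: 'k mpoly set)"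
proof (rule ccontr)
  let ?R = "poly_ring n :: 'k mpoly ring"
  define I where "I = (artinian_ideal n \<Delta> a :: 'k mpoly set)"
  define d where "d = (\<Sum>i\<in>F. a i - 1)"
  assume "(\<Sum>i\<in>F. a i - 1) \<noteq> socle_degree n (artinian_ideal n \<Delta> a :: 'k mpoly set)"
  then have ne: "d \<noteq> socle_degree n I"
    by (simp add: d_def I_def)
  note I_eq = artinian_ideal_eq(1)[OF \<Delta>, of a, where 'k = 'k, folded I_def]
  have I: "ideal I ?R"
    unfolding I_def by (rule artinian_ideal_eq(2)[OF \<Delta>])
  interpret h: ring_hom_ring ?R "?R Quot I" "(+>\<^bsub>?R\<^esub>) I"
    using I by (rule ideal.rcos_ring_hom_ring)
  have F\<Delta>: "F \<in> \<Delta>" and Fn: "F \<subseteq> {1..n}" and "{} \<in> \<Delta>"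
    and max: "\<And>G. G \<in> \<Delta> \<Longrightarrow> F \<subseteq> G \<Longrightarrow> G = F"
    using F \<Delta> by (auto simp: facets_def simplicial_complex_def)
  have fin: "finite F"
    using Fn finite_subset by blast
  \<comment> \<open>The monomial 1 has the empty face as support, and each \<open>a i\<close>
    exceeds its exponent 0.\<close>
  have one: "1 \<notin> I"
    using a \<open>{} \<in> \<Delta>\<close> by (auto simp: I_eq vanishing_monomial_def)
  define m where "m = (\<Sum>i\<in>F. Poly_Mapping.single i (a i - 1))"
  have lookup_m: "Poly_Mapping.lookup m i = (if i \<in> F then a i - 1 else 0)" for i
    unfolding m_def by (rule lookup_sum_single[OF fin])
  \<comment> \<open>Since \<open>2 \<le> a i\<close>, the exponents \<open>a i - 1\<close> are
    positive and no vertex of \<open>F\<close> drops out of the support.\<close>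
  have keys_m: "Poly_Mapping.keys m = F"
    unfolding m_def using a Fn by (intro keys_sum_single[OF fin]) fastforce
  have deg_m: "monom_degree m = d"
    by (simp add: monom_degree_def keys_m lookup_m d_def)
  define p where "p = (Poly_Mapping.single m 1 :: 'k mpoly)"
  have p_carr: "p \<in> carrier ?R"
    using Fn by (simp add: p_def keys_m)
  have "\<not> vanishing_monomial n \<Delta> a m"
    using a F\<Delta> by (fastforce simp: vanishing_monomial_def keys_m lookup_m split: if_splits)
  then have "p \<notin> I"
    by (simp add: I_eq p_def)
  then have nz: "I +>\<^bsub>?R\<^esub> p \<noteq> I"
    using coset_eq_ideal_iff[OF I p_carr] by simp
  have graded: "I +>\<^bsub>?R\<^esub> p \<in> graded_piece n I d"
    using p_carr by (auto simp: graded_piece_def homogeneous_polys_def p_def deg_m)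
  have "I +>\<^bsub>?R\<^esub> p \<in> socle n I"
    unfolding socle_def
  proof (intro CollectI conjI ballI)
    show "I +>\<^bsub>?R\<^esub> p \<in> carrier (?R Quot I)"
      using p_carr by (rule h.hom_closed)
    fix i assume i: "i \<in> {1..n}"
    have v: "var_poly i \<in> carrier ?R"
      using i by (simp add: var_poly_def)
    \<comment> \<open>For \<open>i\<close> in \<open>F\<close> the exponent rises from
      \<open>a i - 1\<close> to \<open>a i\<close>; for other \<open>i\<close> the support grows to
      \<open>insert i F\<close>, a non-face by maximality of \<open>F\<close>.\<close>
    have "Poly_Mapping.keys (m + Poly_Mapping.single i 1) = insert i F"
      by (simp add: keys_add_nat keys_m)
    moreover have "a i \<le> Poly_Mapping.lookup (m + Poly_Mapping.single i 1) i" if "i \<in> F"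
      using that by (simp add: lookup_add lookup_m)
    moreover have "insert i F \<notin> \<Delta>" if "i \<notin> F"
      using that max[of "insert i F"] by blast
    ultimately have "vanishing_monomial n \<Delta> a (m + Poly_Mapping.single i 1)"
      using i unfolding vanishing_monomial_def by metis
    then have "p * var_poly i \<in> I"
      using h.R.m_closed[OF p_carr v] by (simp add: I_eq p_def var_poly_def mult_single)
    then have "I +>\<^bsub>?R\<^esub> (p \<otimes>\<^bsub>?R\<^esub> var_poly i) = I"
      using coset_eq_ideal_iff[OF I h.R.m_closed[OF p_carr v]] by simp
    then show "(I +>\<^bsub>?R\<^esub> p) \<otimes>\<^bsub>?R Quot I\<^esub> (I +>\<^bsub>?R\<^esub> var_poly i) = \<zero>\<^bsub>?R Quot I\<^esub>"
      using h.hom_mult[OF p_carr v] by simp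
  qed
  with graded nz have soc: "socle n I \<inter> graded_piece n I d \<noteq> {I}"
    by blast
  \<comment> \<open>Degree \<open>d\<close> carries a nonzero class, and the nonzero degrees are
    bounded, so the greatest of them is at least \<open>d\<close>.\<close>
  have "d \<le> socle_degree n I"
    unfolding socle_degree_def
  proof (rule Greatest_le_nat)
    show "graded_piece n I d \<noteq> {\<zero>\<^bsub>?R Quot I\<^esub>}"
      using graded nz by auto
    show "e \<le> sum a {1..n}" if "graded_piece n I e \<noteq> {\<zero>\<^bsub>?R Quot I\<^esub>}" for e
      using graded_piece_artinian_nonzero_imp_le[OF \<Delta>] that by (simp add: I_def)
  qed
  then have "socle_vector n I d = 0"
    using lev ne by (simp add: level_def I_def)
  with soc show False
    using socle_vector_eq_0_imp[OF I one] by blast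
qed

section \<open>The non-levelable complex\<close>

lemma simplicial_complex_generated:
  assumes "\<Union>\<F> = {1..n}"
  shows "simplicial_complex n {G. \<exists>F\<in>\<F>. G \<subseteq> F}"
  using assms unfolding simplicial_complex_def by blast

text \<open>A face containing a member \<open>F\<close> of the antichain lies in some member
  \<open>G\<close>; then \<open>F = G\<close>, and the face is squeezed between them.\<close>

lemma facets_generated:
  assumes "\<And>F G. F \<in> \<F> \<Longrightarrow> G \<in> \<F> \<Longrightarrow> F \<subseteq> G \<Longrightarrow> F = G"
  shows "facets {G. \<exists>F\<in>\<F>. G \<subseteq> F} = \<F>"
  using assms unfolding facets_def by blast

theorem theorem4p6:
  fixes n :: nat
  assumes "5 \<le> n"
  shows "\<exists>\<Delta>. simplicial_complex n \<Delta> \<and> (\<forall>F\<in>facets \<Delta>. card F \<noteq> 1)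
    \<and> \<not> levelable TYPE('k::field_char_0) n \<Delta>"
proof -
  define \<F> :: "nat set set" where
    "\<F> = {{1, 2}, {3, 4}, insert 1 (insert 3 {5..n}), insert 2 (insert 4 {5..n})}"
  define \<Delta> where "\<Delta> = {G. \<exists>F\<in>\<F>. G \<subseteq> F}"
  have "\<Union>\<F> = {1..n}"
    using assms by (auto simp: \<F>_def)
  then have \<Delta>: "simplicial_complex n \<Delta>"
    unfolding \<Delta>_def by (rule simplicial_complex_generated)
  have facets: "facets \<Delta> = \<F>"
    unfolding \<Delta>_def
  proof (rule facets_generated)
    show "F = G" if "F \<in> \<F>" "G \<in> \<F>" "F \<subseteq> G" for F G
      using that assms unfolding \<F>_def by (elim insertE emptyE; simp)
  qed
  moreover have "card F \<noteq> 1" if "F \<in> \<F>" for F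
    using that by (auto simp: \<F>_def)
  moreover have "\<not> levelable TYPE('k) n \<Delta>"
  proof
    assume "levelable TYPE('k) n \<Delta>"
    then obtain a where a: "\<forall>i\<in>{1..n}. 2 \<le> a i"
      and lev: "level n (artinian_ideal n \<Delta> a :: 'k mpoly set)"
      by (auto simp: levelable_def)
    define w where "w = socle_degree n (artinian_ideal n \<Delta> a :: 'k mpoly set)"
    have w: "(\<Sum>i\<in>F. a i - 1) = w" if "F \<in> \<F>" for F
      unfolding w_def using facet_weight_eq_socle_degree[OF \<Delta> a lev] that facets by simp
    let ?s = "\<Sum>i\<in>{5..n}. a i - 1"
    \<comment> \<open>As \<open>5 \<le> n\<close>, the vertex 5 contributes to \<open>?s\<close>, so
      \<open>?s\<close> is positive, whereas the four facet equations force it to be 0.\<close>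
    have "a 5 - 1 \<le> ?s"
      using assms by (intro member_le_sum) auto
    moreover have "2 \<le> a 5"
      using a assms by simp
    moreover have "(a 1 - 1) + (a 2 - 1) = w" "(a 3 - 1) + (a 4 - 1) = w"
      "(a 1 - 1) + ((a 3 - 1) + ?s) = w" "(a 2 - 1) + ((a 4 - 1) + ?s) = w"
      using w[of "{1, 2}"] w[of "{3, 4}"] w[of "insert 1 (insert 3 {5..n})"]
        w[of "insert 2 (insert 4 {5..n})"]
      by (simp_all add: \<F>_def)
    ultimately show False
      by linarith
  qed
  ultimately show ?thesis
    using \<Delta> by blast
qed

end
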